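(* For every positive integer $n$, $$SG^{\neg v,\neg n}(n,1)=\sum_{i=1}^{\lfloor n/2\rfloor} SG^{\neg v,\neg n}(n,i,1)\qquad\text{and}\qquad SG(n,1)=\sum_{i=1}^{\lfloor n/2\rfloor+1} SG(n,i,1).$$
   Context: A simple game is a pair $(N,v)$ with $N$ a finite nonempty set of players and $v:2^N\to\{0,1\}$ satisfying $v(\emptyset)=0$, $v(N)=1$ and $v(S)\le v(T)$ whenever $S\subseteq T$. A coalition $S$ is winning if $v(S)=1$ and losing otherwise; it is minimal winning if it is winning and all its proper subsets are losing. Two simple games are isomorphic if there is a bijection of the player sets such that a coalition is winning iff its image is winning. Players $a,b$ are equivalent (equi-desirable) if the transposition of $a$ and $b$ preserves the set of winning coalitions; let $N_1,\dots,N_t$ be the equivalence classes. To a coalition $S$ associate the vector $(|S\cap N_1|,\dots,|S\cap N_t|)$; coalitions with the same vector have the same value under $v$. The vectors of minimal winning coalitions are called minimal winning vectors. A simple game with minimum is a simple game with exactly one minimal winning vector. A player is null if it belongs to no minimal winning coalition, and veto if it belongs to every winning coalition. $SG(n,t,1)$ denotes the number of isomorphism classes of simple games with minimum having $n$ players and exactly $t$ equivalence classes of players, and $SG(n,1)$ the total number of isomorphism classes of simple games with minimum having $n$ players (any number of equivalence classes). $SG^{\neg v,\neg n}(n,t,1)$ and $SG^{\neg v,\neg n}(n,1)$ denote the corresponding numbers when only games containing neither null nor veto players are counted. *)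

theory Defs
  imports "HOL-Library.FuncSet" "HOL-Combinatorics.Transposition"
begin

text \<open>
  A game is a pair \<open>(N, v)\<close>. The value function is extensional on \<open>Pow N\<close>, so that it carries no
  information about sets that are not coalitions.
\<close>

type_synonym 'a game = "'a set \<times> ('a set \<Rightarrow> nat)"

definition simple_game :: "'a set \<Rightarrow> ('a set \<Rightarrow> nat) \<Rightarrow> bool" where
  "simple_game N v \<longleftrightarrow>
     finite N \<and> N \<noteq> {} \<and> v \<in> Pow N \<rightarrow>\<^sub>E {0, 1} \<and> v {} = 0 \<and> v N = 1 \<and>
     (\<forall>S T. S \<subseteq> T \<and> T \<subseteq> N \<longrightarrow> v S \<le> v T)"

definition winning :: "'a set \<Rightarrow> ('a set \<Rightarrow> nat) \<Rightarrow> 'a set \<Rightarrow> bool" where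
  "winning N v S \<longleftrightarrow> S \<subseteq> N \<and> v S = 1"

definition minimal_winning :: "'a set \<Rightarrow> ('a set \<Rightarrow> nat) \<Rightarrow> 'a set \<Rightarrow> bool" where
  "minimal_winning N v S \<longleftrightarrow> winning N v S \<and> (\<forall>T. T \<subset> S \<longrightarrow> \<not> winning N v T)"

definition game_iso :: "('a game \<times> 'a game) set" where
  "game_iso = {((N, v), (M, w)). simple_game N v \<and> simple_game M w \<and>
     (\<exists>f. bij_betw f N M \<and> (\<forall>S. S \<subseteq> N \<longrightarrow> (winning N v S \<longleftrightarrow> winning M w (f ` S))))}"

definition equi_desirable :: "'a set \<Rightarrow> ('a set \<Rightarrow> nat) \<Rightarrow> ('a \<times> 'a) set" where
  "equi_desirable N v = {(a, b). a \<in> N \<and> b \<in> N \<and>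
     (\<forall>S. S \<subseteq> N \<longrightarrow> (winning N v S \<longleftrightarrow> winning N v (transpose a b ` S)))}"

definition player_classes :: "'a set \<Rightarrow> ('a set \<Rightarrow> nat) \<Rightarrow> 'a set set" where
  "player_classes N v = N // equi_desirable N v"

text \<open>
  The vector of a coalition is indexed by the equivalence classes themselves rather than by an
  enumeration \<open>N\<^sub>1, \<dots>, N\<^sub>t\<close> of them, which avoids choosing an order.
\<close>

definition coalition_vector ::
    "'a set \<Rightarrow> ('a set \<Rightarrow> nat) \<Rightarrow> 'a set \<Rightarrow> ('a set \<Rightarrow> nat)" where
  "coalition_vector N v S = (\<lambda>C \<in> player_classes N v. card (S \<inter> C))"

definition minimal_winning_vectors :: "'a set \<Rightarrow> ('a set \<Rightarrow> nat) \<Rightarrow> ('a set \<Rightarrow> nat) set" where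
  "minimal_winning_vectors N v = coalition_vector N v ` {S. minimal_winning N v S}"

definition simple_game_with_minimum :: "'a set \<Rightarrow> ('a set \<Rightarrow> nat) \<Rightarrow> bool" where
  "simple_game_with_minimum N v \<longleftrightarrow>
     simple_game N v \<and> (\<exists>!m. m \<in> minimal_winning_vectors N v)"

definition null_player :: "'a set \<Rightarrow> ('a set \<Rightarrow> nat) \<Rightarrow> 'a \<Rightarrow> bool" where
  "null_player N v a \<longleftrightarrow> a \<in> N \<and> (\<forall>S. minimal_winning N v S \<longrightarrow> a \<notin> S)"

definition veto_player :: "'a set \<Rightarrow> ('a set \<Rightarrow> nat) \<Rightarrow> 'a \<Rightarrow> bool" where
  "veto_player N v a \<longleftrightarrow> a \<in> N \<and> (\<forall>S. winning N v S \<longrightarrow> a \<in> S)"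

text \<open>
  Isomorphism classes are counted among the games whose player set is a finite set of natural
  numbers; every finite simple game is isomorphic to one of these.
\<close>

definition min_games :: "nat \<Rightarrow> nat game set" where
  "min_games n = {(N, v). simple_game_with_minimum N v \<and> card N = n}"

definition min_games_no_veto_null :: "nat \<Rightarrow> nat game set" where
  "min_games_no_veto_null n = {(N, v) \<in> min_games n.
     \<not> (\<exists>a. null_player N v a) \<and> \<not> (\<exists>a. veto_player N v a)}"

definition SG :: "nat \<Rightarrow> nat" where
  "SG n = card (min_games n // game_iso)"

definition SG_classes :: "nat \<Rightarrow> nat \<Rightarrow> nat" where
  "SG_classes n t = card ({(N, v) \<in> min_games n. card (player_classes N v) = t} // game_iso)"

definition SG_nvnn :: "nat \<Rightarrow> nat" where
  "SG_nvnn n = card (min_games_no_veto_null n // game_iso)"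

definition SG_nvnn_classes :: "nat \<Rightarrow> nat \<Rightarrow> nat" where
  "SG_nvnn_classes n t =
     card ({(N, v) \<in> min_games_no_veto_null n. card (player_classes N v) = t} // game_iso)"

end

theory Submission imports Defs
begin

text \<open>
  Isomorphic games have the same number of equivalence classes of players, so the isomorphism
  classes split according to that number \<open>t\<close>; the main point is the range of \<open>t\<close>.

  In a game with minimum, all minimal winning coalitions meet a given class of players in the same
  number of players. For a class with a single player this number is 0 or 1, and that player is
  null in the first case and veto in the second (\<open>singleton_class_null_or_veto\<close>). Without null and
  veto players every class therefore has at least two members, whence \<open>2 t \<le> n\<close>. In general all
  null players are equivalent to one another, and so are all veto players; hence there is at most
  one singleton class of each kind, and \<open>2 t \<le> n + 2\<close>. Both bounds come from
  \<open>twice_card_classes_le\<close>.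

  There are infinitely many games on sets of natural numbers, so the split of the cardinality
  also requires that there are finitely many isomorphism classes with \<open>n\<close> players
  (\<open>finite_isomorphism_classes\<close>).
\<close>

section \<open>Winning coalitions\<close>

lemma winning_superset:
  assumes "simple_game N v" "winning N v S" "S \<subseteq> T" "T \<subseteq> N"
  shows "winning N v T"
proof -
  have "v S \<le> v T" "v \<in> Pow N \<rightarrow>\<^sub>E {0, 1}"
    using assms by (auto simp: simple_game_def)
  moreover from this(2) have "v T \<in> {0, 1}"
    using assms(4) by (auto dest: PiE_mem)
  ultimately have "v S \<le> v T" "v T \<in> {0, 1}" by auto
  then show ?thesis
    using assms by (auto simp: winning_def)
qed

lemma minimal_winning_subset_exists:
  assumes "finite S" "winning N v S"
  shows "\<exists>T\<subseteq>S. minimal_winning N v T"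
  using assms
proof (induction S rule: finite_psubset_induct)
  case (psubset S)
  show ?case
  proof (cases "minimal_winning N v S")
    case False
    then obtain T where "T \<subset> S" "winning N v T"
      using psubset.prems by (auto simp: minimal_winning_def)
    then obtain U where "U \<subseteq> T" "minimal_winning N v U"
      using psubset.IH[of T] by auto
    then show ?thesis
      using \<open>T \<subset> S\<close> by (intro exI[of _ U]) auto
  next
    case True
    then show ?thesis by (intro exI[of _ S]) simp
  qed
qed

lemma veto_playerI:
  assumes "simple_game N v" "a \<in> N" "\<And>S. minimal_winning N v S \<Longrightarrow> a \<in> S"
  shows "veto_player N v a"
  unfolding veto_player_def
proof (intro conjI allI impI)
  fix S assume S: "winning N v S"
  then have "finite S"
    using assms(1) by (auto simp: winning_def simple_game_def intro: finite_subset)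
  then show "a \<in> S"
    using minimal_winning_subset_exists[OF _ S] assms(3) by blast
qed (rule assms(2))

section \<open>Equivalence of players\<close>

lemma transpose_image_subset:
  assumes "a \<in> N" "b \<in> N" "S \<subseteq> N"
  shows "transpose a b ` S \<subseteq> N"
  using assms by (auto simp: transpose_def)

lemma transpose_image_involutory: "transpose a b ` transpose a b ` S = S"
  by (simp add: image_image)

text \<open>
  A transposition is an involution, so preserving winning coalitions in one direction is enough.
\<close>

lemma equi_desirableI:
  assumes "a \<in> N" "b \<in> N"
    and *: "\<And>S. winning N v S \<Longrightarrow> winning N v (transpose a b ` S)"
  shows "(a, b) \<in> equi_desirable N v"
proof -
  have "winning N v S" if "winning N v (transpose a b ` S)" for S
    using *[OF that] by (simp only: transpose_image_involutory)
  then show ?thesis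
    using * assms(1,2) unfolding equi_desirable_def by blast
qed

lemma equi_desirableD:
  assumes "(a, b) \<in> equi_desirable N v" "winning N v S"
  shows "winning N v (transpose a b ` S)"
  using assms by (auto simp: equi_desirable_def winning_def)

lemma equiv_equi_desirable: "equiv N (equi_desirable N v)"
proof (rule equivI)
  show "equi_desirable N v \<subseteq> N \<times> N"
    by (auto simp: equi_desirable_def)
  show "refl_on N (equi_desirable N v)"
    by (auto simp: refl_on_def intro: equi_desirableI)
  show "sym (equi_desirable N v)"
    by (auto simp: sym_def equi_desirable_def transpose_commute)
  show "trans (equi_desirable N v)"
  proof (rule transI)
    fix a b c
    assume ab: "(a, b) \<in> equi_desirable N v" and bc: "(b, c) \<in> equi_desirable N v"
    then have N: "a \<in> N" "b \<in> N" "c \<in> N"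
      by (auto simp: equi_desirable_def)
    show "(a, c) \<in> equi_desirable N v"
    proof (cases "a = c \<or> b = c")
      case True
      then show ?thesis
        using ab N by (auto intro: equi_desirableI)
    next
      case False
      \<comment> \<open>Conjugating \<open>(b c)\<close> by \<open>(a b)\<close> gives \<open>(a c)\<close>.\<close>
      have eq: "transpose a c ` S = transpose a b ` transpose b c ` transpose a b ` S" for S
        using False by (simp add: image_image transpose_triple)
      show ?thesis
      proof (rule equi_desirableI)
        fix S assume "winning N v S"
        then show "winning N v (transpose a c ` S)"
          unfolding eq by (intro equi_desirableD[OF ab] equi_desirableD[OF bc])
      qed (use N in auto)
    qed
  qed
qed

text \<open>
  A winning coalition wins because of a minimal winning one inside it; this core avoids both null
  players, so exchanging them leaves the core in place.
\<close>

lemma null_players_equi_desirable: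
  assumes sg: "simple_game N v" and null: "null_player N v a" "null_player N v b"
  shows "(a, b) \<in> equi_desirable N v"
proof (rule equi_desirableI)
  show N: "a \<in> N" "b \<in> N"
    using null by (auto simp: null_player_def)
  fix S assume S: "winning N v S"
  then have "finite S" "S \<subseteq> N"
    using sg by (auto simp: winning_def simple_game_def intro: finite_subset)
  then obtain T where T: "T \<subseteq> S" "minimal_winning N v T"
    using minimal_winning_subset_exists[OF _ S] by blast
  then have "a \<notin> T" "b \<notin> T"
    using null by (auto simp: null_player_def)
  then have "transpose a b ` T = T"
    by simp
  then have "T \<subseteq> transpose a b ` S"
    using image_mono[OF T(1), of "transpose a b"] by simp
  then show "winning N v (transpose a b ` S)"
    using winning_superset[OF sg] T(2) transpose_image_subset[OF N \<open>S \<subseteq> N\<close>]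
    by (auto simp: minimal_winning_def)
qed

lemma veto_players_equi_desirable:
  assumes "veto_player N v a" "veto_player N v b"
  shows "(a, b) \<in> equi_desirable N v"
proof (rule equi_desirableI)
  fix S assume S: "winning N v S"
  then have "a \<in> S" "b \<in> S"
    using assms by (auto simp: veto_player_def)
  then show "winning N v (transpose a b ` S)"
    using S by simp
qed (use assms in \<open>auto simp: veto_player_def\<close>)

section \<open>Bounding the number of classes of players\<close>

lemma player_class_nonempty: "C \<in> player_classes N v \<Longrightarrow> C \<noteq> {}"
  unfolding player_classes_def by (rule in_quotient_imp_non_empty[OF equiv_equi_desirable])

lemma player_class_subset: "C \<in> player_classes N v \<Longrightarrow> C \<subseteq> N"
  unfolding player_classes_def by (rule in_quotient_imp_subset[OF equiv_equi_desirable])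

lemma player_class_eqI:
  assumes "C \<in> player_classes N v" "D \<in> player_classes N v"
    and "a \<in> C" "b \<in> D" "(a, b) \<in> equi_desirable N v"
  shows "C = D"
  using assms unfolding player_classes_def
  by (intro quotient_eqI[OF equiv_equi_desirable])

lemma finite_player_classes: "finite N \<Longrightarrow> finite (player_classes N v)"
  by (rule finite_subset[of _ "Pow N"]) (auto dest: player_class_subset)

lemma card_player_classes_pos:
  assumes "simple_game N v"
  shows "card (player_classes N v) \<ge> 1"
proof -
  have "finite N" "N \<noteq> {}"
    using assms by (auto simp: simple_game_def)
  then have "player_classes N v \<noteq> {}" "finite (player_classes N v)"
    by (simp_all add: finite_player_classes) (simp add: player_classes_def)
  then show ?thesis
    by (simp add: Suc_le_eq card_gt_0_iff)
qed

text \<open>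
  Uniqueness of the minimal winning vector makes membership of \<open>a\<close> the same for all minimal
  winning coalitions. If none contains \<open>a\<close>, the player is null; if all do, it is veto, because every
  winning coalition contains a minimal one.
\<close>

lemma singleton_class_null_or_veto:
  assumes g: "simple_game_with_minimum N v" and a: "{a} \<in> player_classes N v"
  shows "null_player N v a \<or> veto_player N v a"
proof -
  have sg: "simple_game N v" and "\<exists>!m. m \<in> minimal_winning_vectors N v"
    using g by (auto simp: simple_game_with_minimum_def)
  then have "coalition_vector N v S {a} = coalition_vector N v T {a}"
    if "minimal_winning N v S" "minimal_winning N v T" for S T
    using that unfolding minimal_winning_vectors_def by (metis imageI mem_Collect_eq)
  then have same: "card (S \<inter> {a}) = card (T \<inter> {a})"
    if "minimal_winning N v S" "minimal_winning N v T" for S T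
    unfolding coalition_vector_def restrict_apply'[OF a] using that .
  have "a \<in> T" if "minimal_winning N v S" "a \<in> S" "minimal_winning N v T" for S T
    using same[OF that(1,3)] that(2) by (cases "a \<in> T") auto
  moreover have "a \<in> N"
    using player_class_subset[OF a] by simp
  ultimately show ?thesis
    using veto_playerI[OF sg] unfolding null_player_def by blast
qed

text \<open>
  The partition of the players into classes bounds \<open>t\<close>: a class that is not a singleton uses up
  two players, and each singleton costs one unit of slack.
\<close>

lemma twice_card_classes_le:
  assumes "finite N"
  shows "2 * card (player_classes N v)
           \<le> card N + card {C \<in> player_classes N v. card C = 1}"
proof -
  let ?P = "player_classes N v"
  have finP: "finite ?P"
    using assms by (rule finite_player_classes)
  have finC: "finite C" if "C \<in> ?P" for C
    using player_class_subset[OF that] assms by (rule finite_subset)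
  have "\<Union>?P = N"
    unfolding player_classes_def by (rule Union_quotient[OF equiv_equi_desirable])
  moreover have "pairwise disjnt ?P"
    unfolding player_classes_def pairwise_def disjnt_def
    using quotient_disj[OF equiv_equi_desirable] by blast
  ultimately have N: "card N = (\<Sum>C\<in>?P. card C)"
    using card_Union_disjoint[of ?P] finC by simp
  have "2 * card ?P = (\<Sum>C\<in>?P. 2)"
    by simp
  also have "\<dots> \<le> (\<Sum>C\<in>?P. card C + (if card C = 1 then 1 else 0))"
  proof (rule sum_mono)
    fix C assume "C \<in> ?P"
    then have "card C > 0"
      using finC player_class_nonempty by (simp add: card_gt_0_iff)
    then show "2 \<le> card C + (if card C = 1 then 1 else 0)"
      by auto
  qed
  also have "\<dots> = card N + card {C \<in> ?P. card C = 1}"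
    unfolding N sum.distrib using finP by (simp add: sum.If_cases Int_def)
  finally show ?thesis .
qed

lemma card_classes_le_no_veto_null:
  assumes g: "simple_game_with_minimum N v"
    and "\<not> (\<exists>a. null_player N v a)" "\<not> (\<exists>a. veto_player N v a)"
  shows "card (player_classes N v) \<le> card N div 2"
proof -
  have fin: "finite N"
    using g by (auto simp: simple_game_with_minimum_def simple_game_def)
  have none: "{C \<in> player_classes N v. card C = 1} = {}"
    using singleton_class_null_or_veto[OF g] assms(2,3) by (auto simp: card_1_singleton_iff)
  show ?thesis
    using twice_card_classes_le[OF fin, of v] unfolding none by simp
qed

text \<open>
  Null players are equivalent to one another, and so are veto players, so there are at most two
  singleton classes.
\<close>

lemma card_classes_le:
  assumes g: "simple_game_with_minimum N v"
  shows "card (player_classes N v) \<le> card N div 2 + 1"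
proof -
  have sg: "simple_game N v" and fin: "finite N"
    using g by (auto simp: simple_game_with_minimum_def simple_game_def)
  define Z where "Z = {C \<in> player_classes N v. card C = 1}"
  define Z0 where "Z0 = {C \<in> Z. \<exists>a\<in>C. null_player N v a}"
  define Z1 where "Z1 = {C \<in> Z. \<exists>a\<in>C. veto_player N v a}"
  have "Z \<subseteq> Z0 \<union> Z1"
    using singleton_class_null_or_veto[OF g]
    by (auto simp: Z_def Z0_def Z1_def card_1_singleton_iff)
  moreover have "finite Z"
    using finite_player_classes[OF fin] by (simp add: Z_def)
  then have "finite Z0" "finite Z1"
    by (auto simp: Z0_def Z1_def)
  moreover have "C = D" if "C \<in> Z0" "D \<in> Z0" for C D
  proof -
    from that obtain a b where "a \<in> C" "null_player N v a" "b \<in> D" "null_player N v b"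
      by (auto simp: Z0_def)
    moreover have "C \<in> player_classes N v" "D \<in> player_classes N v"
      using that by (auto simp: Z0_def Z_def)
    ultimately show "C = D"
      using player_class_eqI[of C N v D a b] null_players_equi_desirable[OF sg, of a b]
      by simp
  qed
  then have "card Z0 \<le> 1"
    unfolding One_nat_def using card_le_Suc0_iff_eq[OF \<open>finite Z0\<close>] by blast
  moreover have "C = D" if "C \<in> Z1" "D \<in> Z1" for C D
  proof -
    from that obtain a b where "a \<in> C" "veto_player N v a" "b \<in> D" "veto_player N v b"
      by (auto simp: Z1_def)
    moreover have "C \<in> player_classes N v" "D \<in> player_classes N v"
      using that by (auto simp: Z1_def Z_def)
    ultimately show "C = D"
      using player_class_eqI[of C N v D a b] veto_players_equi_desirable[of N v a b]
      by simp
  qed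
  then have "card Z1 \<le> 1"
    unfolding One_nat_def using card_le_Suc0_iff_eq[OF \<open>finite Z1\<close>] by blast
  ultimately have "card Z \<le> 2"
    using card_mono[of "Z0 \<union> Z1" Z] card_Un_le[of Z0 Z1] by simp
  then show ?thesis
    using twice_card_classes_le[OF fin, of v] unfolding Z_def by linarith
qed

section \<open>Isomorphism of games\<close>

lemma game_isoI:
  assumes "simple_game N v" "simple_game M w" "bij_betw f N M"
    and "\<And>S. S \<subseteq> N \<Longrightarrow> winning N v S \<longleftrightarrow> winning M w (f ` S)"
  shows "((N, v), (M, w)) \<in> game_iso"
  using assms by (auto simp: game_iso_def)

lemma game_isoE:
  assumes "((N, v), (M, w)) \<in> game_iso"
  obtains f where "simple_game N v" "simple_game M w" "bij_betw f N M"
    "\<And>S. S \<subseteq> N \<Longrightarrow> winning N v S \<longleftrightarrow> winning M w (f ` S)"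
  using assms by (auto simp: game_iso_def)

lemma game_iso_sym:
  assumes "((N, v), (M, w)) \<in> game_iso"
  shows "((M, w), (N, v)) \<in> game_iso"
proof -
  obtain f where f: "simple_game N v" "simple_game M w" "bij_betw f N M"
    "\<And>S. S \<subseteq> N \<Longrightarrow> winning N v S \<longleftrightarrow> winning M w (f ` S)"
    using assms by (rule game_isoE) blast
  show ?thesis
  proof (rule game_isoI[where f = "inv_into N f"])
    fix S assume "S \<subseteq> M"
    then have "inv_into N f ` S \<subseteq> N" "f ` inv_into N f ` S = S"
      using f(3) by (auto simp: bij_betw_def image_inv_into_cancel inv_into_into)
    then show "winning M w S \<longleftrightarrow> winning N v (inv_into N f ` S)"
      using f(4)[of "inv_into N f ` S"] by simp
  qed (use f in \<open>auto intro: bij_betw_inv_into\<close>)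
qed

lemma game_iso_trans:
  assumes "((N, v), (M, w)) \<in> game_iso" "((M, w), (K, u)) \<in> game_iso"
  shows "((N, v), (K, u)) \<in> game_iso"
proof -
  obtain f where f: "simple_game N v" "bij_betw f N M"
      "\<And>S. S \<subseteq> N \<Longrightarrow> winning N v S \<longleftrightarrow> winning M w (f ` S)"
    using assms(1) by (rule game_isoE) blast
  obtain g where g: "simple_game K u" "bij_betw g M K"
      "\<And>S. S \<subseteq> M \<Longrightarrow> winning M w S \<longleftrightarrow> winning K u (g ` S)"
    using assms(2) by (rule game_isoE) blast
  show ?thesis
  proof (rule game_isoI[where f = "g \<circ> f"])
    fix S assume "S \<subseteq> N"
    then have "f ` S \<subseteq> M"
      using f(2) by (auto simp: bij_betw_def)
    then show "winning N v S \<longleftrightarrow> winning K u ((g \<circ> f) ` S)"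
      using f(3)[OF \<open>S \<subseteq> N\<close>] g(3) by (simp add: image_comp)
  qed (use f g in \<open>auto intro: bij_betw_trans\<close>)
qed

lemma equiv_game_iso: "equiv {(N, v). simple_game N v} game_iso"
proof (rule equivI)
  show "game_iso \<subseteq> {(N, v). simple_game N v} \<times> {(N, v). simple_game N v}"
    by (auto simp: game_iso_def)
  show "refl_on {(N, v). simple_game N v} game_iso"
    by (auto simp: refl_on_def intro!: game_isoI[where f = id])
  show "sym game_iso"
    unfolding sym_def split_paired_All using game_iso_sym by blast
  show "trans game_iso"
    unfolding trans_def split_paired_All using game_iso_trans by blast
qed

text \<open>
  An isomorphism conjugates transpositions to transpositions, so it carries classes of players to
  classes of players.
\<close>

lemma game_iso_card_player_classes:
  assumes "((N, v), (M, w)) \<in> game_iso"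
  shows "card (player_classes N v) = card (player_classes M w)"
proof -
  obtain f where bij: "bij_betw f N M"
    and win: "\<And>S. S \<subseteq> N \<Longrightarrow> winning N v S \<longleftrightarrow> winning M w (f ` S)"
    using assms by (rule game_isoE) blast
  have inj: "inj_on f N" and fN: "f ` N = M"
    using bij by (auto simp: bij_betw_def)
  have equi: "(a, b) \<in> equi_desirable N v \<longleftrightarrow> (f a, f b) \<in> equi_desirable M w"
    if ab: "a \<in> N" "b \<in> N" for a b
  proof -
    have conj: "f ` transpose a b ` S = transpose (f a) (f b) ` f ` S" if "S \<subseteq> N" for S
      unfolding image_image
      by (rule image_cong) (use that ab inj in \<open>auto simp: transpose_def inj_on_eq_iff subset_iff\<close>)
    have "(a, b) \<in> equi_desirable N v \<longleftrightarrow>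
        (\<forall>S\<in>Pow N. winning M w (f ` S) \<longleftrightarrow> winning M w (transpose (f a) (f b) ` f ` S))"
      using ab win conj transpose_image_subset[OF ab] by (auto simp: equi_desirable_def)
    also have "\<dots> \<longleftrightarrow>
        (\<forall>T\<in>(`) f ` Pow N. winning M w T \<longleftrightarrow> winning M w (transpose (f a) (f b) ` T))"
      by blast
    also have "(`) f ` Pow N = Pow M"
      using fN by (simp add: image_Pow_surj)
    finally show ?thesis
      using ab fN by (auto simp: equi_desirable_def)
  qed
  have img: "f ` (equi_desirable N v `` {a}) = equi_desirable M w `` {f a}" if a: "a \<in> N" for a
  proof
    show "f ` (equi_desirable N v `` {a}) \<subseteq> equi_desirable M w `` {f a}"
      using equi a by (auto simp: equi_desirable_def[of N])
    show "equi_desirable M w `` {f a} \<subseteq> f ` (equi_desirable N v `` {a})"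
    proof
      fix c assume c: "c \<in> equi_desirable M w `` {f a}"
      then have "c \<in> f ` N"
        using fN by (auto simp: equi_desirable_def)
      then show "c \<in> f ` (equi_desirable N v `` {a})"
        using c equi[OF a] by auto
    qed
  qed
  have "(`) f ` player_classes N v = (\<lambda>a. equi_desirable M w `` {f a}) ` N"
    unfolding player_classes_def quotient_def using img
    by (simp add: UNION_singleton_eq_range image_image)
  also have "\<dots> = player_classes M w"
    unfolding player_classes_def quotient_def fN[symmetric]
    by (simp add: UNION_singleton_eq_range image_image)
  finally have "(`) f ` player_classes N v = player_classes M w" .
  moreover have "inj_on ((`) f) (player_classes N v)"
    using inj_on_image_Pow[OF inj] by (rule inj_on_subset) (auto dest: player_class_subset)
  ultimately show ?thesis
    using card_image by metis
qed

text \<open>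
  After numbering its players by \<open>0, \<dots>, n - 1\<close>, a game is determined up to isomorphism by its
  family of winning coalitions, a subset of the power set of an \<open>n\<close>-element set.
\<close>

lemma finite_isomorphism_classes:
  assumes A: "\<And>N v. (N, v) \<in> A \<Longrightarrow> simple_game N v \<and> card N = n"
  shows "finite (A // game_iso)"
proof -
  have "\<exists>f. bij_betw f N {..<n}" if "finite N" "card N = n" for N :: "'a set"
    using that by (metis bij_betw_iff_card card_lessThan finite_lessThan)
  then obtain e where e: "\<And>N :: 'a set. finite N \<Longrightarrow> card N = n \<Longrightarrow> bij_betw (e N) N {..<n}"
    by metis
  define h where "h = (\<lambda>(N, v). (`) (e N) ` {S. winning N v S})"
  \<comment> \<open>Composing one numbering with the inverse of the other gives the isomorphism.\<close>
  have h_iso: "((N, v), (M, w)) \<in> game_iso"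
    if "(N, v) \<in> A" "(M, w) \<in> A" and h: "h (N, v) = h (M, w)" for N v M w
  proof (rule game_isoI[where f = "inv_into M (e M) \<circ> e N"])
    show sg: "simple_game N v" "simple_game M w"
      using A that by auto
    then have eN: "bij_betw (e N) N {..<n}" and eM: "bij_betw (e M) M {..<n}"
      using A that e by (auto simp: simple_game_def)
    have char: "winning K u S \<longleftrightarrow> e K ` S \<in> h (K, u)"
      if "bij_betw (e K) K {..<n}" "S \<subseteq> K" for K u S
    proof -
      have "S = T" if "e K ` S = e K ` T" "T \<subseteq> K" for T
        using that \<open>S \<subseteq> K\<close> \<open>bij_betw (e K) K {..<n}\<close>
        by (auto simp: bij_betw_def inj_on_image_eq_iff)
      then show ?thesis
        by (auto simp: h_def winning_def)
    qed
    show "bij_betw (inv_into M (e M) \<circ> e N) N M"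
      using eN eM by (auto intro: bij_betw_trans bij_betw_inv_into)
    fix S assume S: "S \<subseteq> N"
    let ?T = "(inv_into M (e M) \<circ> e N) ` S"
    have "e N ` S \<subseteq> e M ` M"
      using S eN eM by (auto simp: bij_betw_def)
    then have "e M ` inv_into M (e M) ` e N ` S = e N ` S" "inv_into M (e M) ` e N ` S \<subseteq> M"
      by (auto simp: image_inv_into_cancel[OF refl] inv_into_into)
    then have "e M ` ?T = e N ` S" "?T \<subseteq> M"
      by (simp_all only: image_comp)
    then show "winning N v S \<longleftrightarrow> winning M w ?T"
      using char[OF eN S] char[OF eM \<open>?T \<subseteq> M\<close>] h by simp
  qed
  have "h ` A \<subseteq> Pow (Pow {..<n})"
  proof clarify
    fix N v S x assume "(N, v) \<in> A" "S \<in> h (N, v)" "x \<in> S"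
    then show "x < n"
      using A[of N v] e[of N] by (auto simp: h_def winning_def simple_game_def bij_betw_def)
  qed
  then have "finite (h ` A)"
    by (rule finite_subset) simp
  then obtain B where B: "B \<subseteq> A" "finite B" "h ` A = h ` B"
    using finite_subset_image[of "h ` A" h A] by auto
  have "A // game_iso \<subseteq> (\<lambda>x. game_iso `` {x}) ` B"
  proof
    fix X assume "X \<in> A // game_iso"
    then obtain x where x: "x \<in> A" "X = game_iso `` {x}"
      by (rule quotientE)
    then obtain y where y: "y \<in> B" "h x = h y"
      using B(3) by blast
    then have "(x, y) \<in> game_iso"
      using h_iso x(1) B(1) by (cases x, cases y) auto
    then show "X \<in> (\<lambda>x. game_iso `` {x}) ` B"
      using x(2) y(1) equiv_class_eq[OF equiv_game_iso] by blast
  qed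
  then show ?thesis
    using B(2) by (blast intro: finite_subset)
qed

section \<open>Splitting the count by the number of classes\<close>

text \<open>
  An invariant of the relation separates the equivalence classes, so the quotients of its level
  sets are pairwise disjoint.
\<close>

lemma card_quotient_split_invariant:
  assumes r: "equiv X r" and A: "A \<subseteq> X" and fin: "finite (A // r)" and I: "finite I"
    and range: "\<And>x. x \<in> A \<Longrightarrow> t x \<in> I"
    and inv: "\<And>x y. (x, y) \<in> r \<Longrightarrow> t x = t y"
  shows "card (A // r) = (\<Sum>i\<in>I. card ({x \<in> A. t x = i} // r))"
proof -
  have un: "A // r = (\<Union>i\<in>I. {x \<in> A. t x = i} // r)"
    using range by (auto simp: quotient_def)
  have disj: "({x \<in> A. t x = i} // r) \<inter> ({x \<in> A. t x = j} // r) = {}" if "i \<noteq> j" for i j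
  proof -
    have "t x = t y" if "x \<in> A" "y \<in> A" "r `` {x} = r `` {y}" for x y
      using that A eq_equiv_class[OF _ r] inv by blast
    then show ?thesis
      using \<open>i \<noteq> j\<close> by (auto simp: quotient_def)
  qed
  have "finite ({x \<in> A. t x = i} // r)" for i
    by (rule finite_subset[OF _ fin]) (auto simp: quotient_def)
  then show ?thesis
    unfolding un using I disj by (intro card_UN_disjoint) auto
qed

lemma card_isomorphism_classes_split:
  assumes A: "\<And>N v. (N, v) \<in> A \<Longrightarrow> simple_game N v \<and> card N = n"
    and bound: "\<And>N v. (N, v) \<in> A \<Longrightarrow> card (player_classes N v) \<le> k"
  shows "card (A // game_iso) =
    (\<Sum>i = 1..k. card ({(N, v) \<in> A. card (player_classes N v) = i} // game_iso))"
proof -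
  define t where "t = (\<lambda>(N :: 'a set, v). card (player_classes N v))"
  have "card (A // game_iso) = (\<Sum>i = 1..k. card ({x \<in> A. t x = i} // game_iso))"
  proof (rule card_quotient_split_invariant[OF equiv_game_iso])
    show "A \<subseteq> {(N, v). simple_game N v}"
      using A by auto
    show "finite (A // game_iso)"
      using A by (rule finite_isomorphism_classes)
    show "t x \<in> {1..k}" if "x \<in> A" for x
    proof -
      obtain N v where "x = (N, v)"
        by (cases x)
      then show ?thesis
        using that A[of N v] bound[of N v] card_player_classes_pos[of N v] by (simp add: t_def)
    qed
    show "t x = t y" if "(x, y) \<in> game_iso" for x y
      using that game_iso_card_player_classes by (cases x, cases y) (auto simp: t_def)
  qed simp
  moreover have "{x \<in> A. t x = i} = {(N, v) \<in> A. card (player_classes N v) = i}" for i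
    by (auto simp: t_def)
  ultimately show ?thesis by simp
qed

theorem theorem3p16:
  fixes n :: nat
  assumes "n \<ge> 1"
  shows "SG_nvnn n = (\<Sum>i = 1..n div 2. SG_nvnn_classes n i) \<and>
         SG n = (\<Sum>i = 1..n div 2 + 1. SG_classes n i)"
proof
  have mg: "simple_game N v \<and> card N = n" if "(N, v) \<in> min_games n" for N v
    using that by (auto simp: min_games_def simple_game_with_minimum_def)
  show "SG_nvnn n = (\<Sum>i = 1..n div 2. SG_nvnn_classes n i)"
    unfolding SG_nvnn_def SG_nvnn_classes_def
  proof (rule card_isomorphism_classes_split)
    fix N v assume g: "(N, v) \<in> min_games_no_veto_null n"
    show "simple_game N v \<and> card N = n"
      using g by (auto simp: min_games_no_veto_null_def intro!: mg)
    show "card (player_classes N v) \<le> n div 2"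
      using g card_classes_le_no_veto_null[of N v]
      by (auto simp: min_games_no_veto_null_def min_games_def)
  qed
  show "SG n = (\<Sum>i = 1..n div 2 + 1. SG_classes n i)"
    unfolding SG_def SG_classes_def
  proof (rule card_isomorphism_classes_split)
    fix N v assume g: "(N, v) \<in> min_games n"
    show "simple_game N v \<and> card N = n"
      using g by (rule mg)
    show "card (player_classes N v) \<le> n div 2 + 1"
      using g card_classes_le[of N v] by (auto simp: min_games_def)
  qed
qed

end
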